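(* Let $a=(\mathcal{N}_0^a,\mathcal{N}_1^a)$ and $b=(\mathcal{N}_0^b,\mathcal{N}_1^b)$ be any two nodes in a branch-and-cut search tree of the formulation (MINLP) described in the context, and let $c$ be their first (i.e., lowest) common ancestor. If $c$ differs from $a$ and from $b$, then $$\mathrm{Proj}_x\big(\mathcal{F}^{\mathrm{MINLP}}(\mathcal{N}_0^a,\mathcal{N}_1^a)\big)\cap \mathrm{Proj}_x\big(\mathcal{F}^{\mathrm{MINLP}}(\mathcal{N}_0^b,\mathcal{N}_1^b)\big)=\varnothing .$$
   Context: Notation: $[n]=\{1,\dots,n\}$. For $u,w\in\mathbb{R}^m$, $u\ge w$ means $u_k\ge w_k$ for all $k\in[m]$, and $u\ngeq w$ means $u_k<w_k$ for at least one $k\in[m]$. Data: a polyhedron $\mathcal{X}\subseteq\mathbb{R}^d$, an $m\times d$ real matrix $T$, $c_{\mathrm{obj}}\in\mathbb{R}^d$ (the cost vector), vectors $\xi^1,\dots,\xi^n\in\mathbb{R}^m$ with $\xi^i\ge 0$, probabilities $p_i\ge0$ with $\sum_{i=1}^n p_i=1$, and $\epsilon\in(0,1)$. (MINLP) is the problem of minimizing $c_{\mathrm{obj}}^\top x$ over the set $\mathcal{F}^{\mathrm{MINLP}}$ of all $(x,v,z)$ satisfying: $Tx=v$, $x\in\mathcal{X}$; $v\ge \xi^i(1-z_i)$ for all $i\in[n]$; $\sum_{i=1}^n p_iz_i\le\epsilon$; $v\in\mathbb{R}^m_+$, $z\in\{0,1\}^n$; and the if-then constraints $z_i=1\Rightarrow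 v\ngeq \xi^i$ for all $i\in[n]$. Search tree: a rooted binary tree in which each node is labelled by a pair $(\mathcal{N}_0,\mathcal{N}_1)$ of disjoint subsets of $[n]$, the index sets of the variables $z_i$ fixed to $0$ and to $1$ at that node (by branching or by other fixing methods). Each node that has children branches on some variable $z_j$ with $j\in[n]\setminus(\mathcal{N}_0\cup\mathcal{N}_1)$: in the left branch $z_j$ is fixed to $0$ and in the right branch $z_j$ is fixed to $1$. All fixings at a node are inherited by all of its descendants. (The variables $x$ are continuous, so branching takes place only on the variables $z$.) A node counts as an ancestor of itself when forming common ancestors. For a node $(\mathcal{N}_0,\mathcal{N}_1)$, its feasible region is $\mathcal{F}^{\mathrm{MINLP}}(\mathcal{N}_0,\mathcal{N}_1)=\{(x,v,z)\in\mathcal{F}^{\mathrm{MINLP}}: z_i=0\ \forall i\in\mathcal{N}_0,\ z_i=1\ \forall i\in\mathcal{N}_1\}$. $\mathrm{Proj}_x$ denotes projection onto the $x$-space. *)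

theory Defs
  imports "HOL-Analysis.Analysis" "HOL-Library.Sublist"
begin

text \<open>
  The index sets \<open>[d]\<close>, \<open>[m]\<close>, \<open>[n]\<close> are the finite types \<open>'d\<close>, \<open>'m\<close>, \<open>'n\<close>.
  The library order on \<open>real ^ 'm\<close> is the componentwise one.
\<close>

record ('d, 'm, 'n) minlp =
  polyh :: "(real ^ 'd) set"
  tmat  :: "real ^ 'd ^ 'm"
  cobj  :: "real ^ 'd"
  scen  :: "'n \<Rightarrow> real ^ 'm"  \<comment> \<open>\<open>scen P i\<close> is the vector \<open>\<xi>\<^sup>i\<close>\<close>
  prob  :: "'n \<Rightarrow> real"
  eps   :: real

definition minlp_data :: "('d::finite, 'm::finite, 'n::finite) minlp \<Rightarrow> bool" where
  "minlp_data P \<longleftrightarrow>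
     polyhedron (polyh P) \<and>
     (\<forall>i. scen P i \<ge> 0) \<and>
     (\<forall>i. prob P i \<ge> 0) \<and> (\<Sum>i\<in>UNIV. prob P i) = 1 \<and>
     0 < eps P \<and> eps P < 1"

definition not_ge :: "real ^ 'm \<Rightarrow> real ^ 'm \<Rightarrow> bool" where
  "not_ge u w \<longleftrightarrow> (\<exists>k. u $ k < w $ k)"

definition F_minlp ::
  "('d::finite, 'm::finite, 'n::finite) minlp \<Rightarrow> ((real ^ 'd) \<times> (real ^ 'm) \<times> (real ^ 'n)) set" where
  "F_minlp P = {(x, v, z).
     tmat P *v x = v \<and> x \<in> polyh P \<and>
     (\<forall>i. v \<ge> (1 - z $ i) *\<^sub>R scen P i) \<and>
     (\<Sum>i\<in>UNIV. prob P i * z $ i) \<le> eps P \<and>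
     v \<ge> 0 \<and> (\<forall>i. z $ i \<in> {0, 1}) \<and>
     (\<forall>i. z $ i = 1 \<longrightarrow> not_ge v (scen P i))}"

text \<open>
  (MINLP) minimizes this function over \<open>F_minlp P\<close>; the feasible regions of the nodes of a search
  tree do not depend on it.
\<close>

definition objective ::
  "('d::finite, 'm::finite, 'n::finite) minlp \<Rightarrow> (real ^ 'd) \<times> (real ^ 'm) \<times> (real ^ 'n) \<Rightarrow> real" where
  "objective P = (\<lambda>(x, v, z). cobj P \<bullet> x)"

definition F_node ::
  "('d::finite, 'm::finite, 'n::finite) minlp \<Rightarrow> 'n set \<times> 'n set
     \<Rightarrow> ((real ^ 'd) \<times> (real ^ 'm) \<times> (real ^ 'n)) set" where
  "F_node P = (\<lambda>(N0, N1).
     {(x, v, z) \<in> F_minlp P. (\<forall>i\<in>N0. z $ i = 0) \<and> (\<forall>i\<in>N1. z $ i = 1)})"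

definition Proj_x :: "('x \<times> 'v \<times> 'z) set \<Rightarrow> 'x set" where
  "Proj_x S = fst ` S"

text \<open>
  A node of a rooted binary tree is identified with the sequence of turns on the path from the root
  to it. A tree is then a prefix-closed set of such sequences containing the empty one (the root),
  and \<open>prefix u w\<close> says that \<open>u\<close> is an ancestor of \<open>w\<close>, every node being an ancestor of itself.
\<close>

datatype turn = L | R

type_synonym node = "turn list"

definition binary_tree :: "node set \<Rightarrow> bool" where
  "binary_tree V \<longleftrightarrow> [] \<in> V \<and> (\<forall>w\<in>V. \<forall>u. prefix u w \<longrightarrow> u \<in> V)"

text \<open>
  \<open>lab u = (N0, N1)\<close> holds the indices of the variables fixed to 0 and to 1 at \<open>u\<close>. Labels may
  contain more than the inherited and branching fixings, and the root may already carry
  fixings. A node may have only one of its two children.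
\<close>

definition search_tree :: "node set \<Rightarrow> (node \<Rightarrow> 'n set \<times> 'n set) \<Rightarrow> bool" where
  "search_tree V lab \<longleftrightarrow>
     binary_tree V \<and>
     (\<forall>u\<in>V. fst (lab u) \<inter> snd (lab u) = {}) \<and>
     (\<forall>u\<in>V. \<forall>w\<in>V. prefix u w \<longrightarrow> fst (lab u) \<subseteq> fst (lab w) \<and> snd (lab u) \<subseteq> snd (lab w)) \<and>
     (\<forall>u\<in>V. u @ [L] \<in> V \<or> u @ [R] \<in> V \<longrightarrow>
        (\<exists>j. j \<notin> fst (lab u) \<union> snd (lab u) \<and>
             (u @ [L] \<in> V \<longrightarrow> j \<in> fst (lab (u @ [L]))) \<and>
             (u @ [R] \<in> V \<longrightarrow> j \<in> snd (lab (u @ [R])))))"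

definition common_ancestor :: "node set \<Rightarrow> node \<Rightarrow> node \<Rightarrow> node \<Rightarrow> bool" where
  "common_ancestor V a b c \<longleftrightarrow> c \<in> V \<and> prefix c a \<and> prefix c b"

definition lowest_common_ancestor :: "node set \<Rightarrow> node \<Rightarrow> node \<Rightarrow> node \<Rightarrow> bool" where
  "lowest_common_ancestor V a b c \<longleftrightarrow>
     common_ancestor V a b c \<and> (\<forall>c'. common_ancestor V a b c' \<longrightarrow> prefix c' c)"

end

theory Submission imports Defs begin

text \<open>
  The if-then constraints make \<open>z\<close> a function of \<open>x\<close>: on \<open>F_minlp P\<close> the entry \<open>z\<^sub>i\<close> is 1 exactly
  when \<open>T x\<close> fails to dominate \<open>\<xi>\<^sup>i\<close>. Two nodes in different branches below their lowest common
  ancestor fix the branching variable to different values, so no \<open>x\<close> is feasible for both.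
\<close>

text \<open>One direction is the if-then constraint. Conversely, \<open>z $ i = 0\<close> would turn
  the scenario constraint into \<open>v \<ge> scen P i\<close>, so integrality leaves only 1.
  Writing \<open>tmat P *v x\<close> for \<open>v\<close> allows two points to be compared that
  share only \<open>x\<close>.\<close>

lemma F_minlp_z_eq_1_iff:
  assumes "(x, v, z) \<in> F_minlp P"
  shows "z $ i = 1 \<longleftrightarrow> not_ge (tmat P *v x) (scen P i)"
proof
  assume "z $ i = 1"
  then show "not_ge (tmat P *v x) (scen P i)"
    using assms by (auto simp: F_minlp_def)
next
  assume "not_ge (tmat P *v x) (scen P i)"
  then have "\<not> scen P i \<le> v"
    using assms by (auto simp: F_minlp_def not_ge_def less_eq_vec_def not_le)
  moreover have "(1 - z $ i) *\<^sub>R scen P i \<le> v" and "z $ i = 0 \<or> z $ i = 1"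
    using assms by (auto simp: F_minlp_def)
  ultimately show "z $ i = 1"
    by auto
qed

lemma Proj_x_F_node_disjoint:
  assumes "j \<in> fst A" and "j \<in> snd B"
  shows "Proj_x (F_node P A) \<inter> Proj_x (F_node P B) = {}"
proof -
  have False
    if "(x, v, z) \<in> F_node P A" and "(x, v', z') \<in> F_node P B" for x v z v' z'
  proof -
    have "(x, v, z) \<in> F_minlp P" "z $ j = 0" and "(x, v', z') \<in> F_minlp P" "z' $ j = 1"
      using that assms by (auto simp: F_node_def split: prod.splits)
    \<comment> \<open>Both equivalences have the same right-hand side, which depends only on
      \<open>x\<close> and \<open>j\<close>, so \<open>z $ j\<close> and \<open>z' $ j\<close>
      cannot differ.\<close>
    then show False
      using F_minlp_z_eq_1_iff[of x v z P j] F_minlp_z_eq_1_iff[of x v' z' P j] by simp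
  qed
  then show ?thesis
    by (force simp: Proj_x_def)
qed

text \<open>The two children of \<open>c\<close> fix the same branching variable to opposite values,
  and their descendants inherit these fixings.\<close>

lemma search_tree_branching_fixing:
  assumes "search_tree V lab"
    and "u \<in> V" and "w \<in> V"
    and "prefix (c @ [L]) u" and "prefix (c @ [R]) w"
  obtains j where "j \<in> fst (lab u)" and "j \<in> snd (lab w)"
proof -
  have tree: "binary_tree V"
    using assms(1) by (simp add: search_tree_def)
  \<comment> \<open>With both children present, both branching clauses hold for one and the same
    \<open>j\<close>.\<close>
  have V: "c @ [L] \<in> V" "c @ [R] \<in> V"
    using tree assms by (auto simp: binary_tree_def)
  then have "c \<in> V"
    using tree by (metis binary_tree_def prefixI)
  then obtain j where "j \<in> fst (lab (c @ [L]))" and "j \<in> snd (lab (c @ [R]))"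
    using assms(1) V by (auto simp: search_tree_def)
  moreover have "fst (lab (c @ [L])) \<subseteq> fst (lab u)" and "snd (lab (c @ [R])) \<subseteq> snd (lab w)"
    using assms V by (simp_all add: search_tree_def)
  ultimately show thesis
    using that by blast
qed

text \<open>If the paths to \<open>a\<close> and \<open>b\<close> left \<open>c\<close> by the same
  turn, that child of \<open>c\<close> would be a lower common ancestor.\<close>

lemma lowest_common_ancestor_turns:
  assumes "binary_tree V" and "a \<in> V"
    and lca: "lowest_common_ancestor V a b c"
    and "c \<noteq> a" and "c \<noteq> b"
  obtains s t where "s \<noteq> t" and "prefix (c @ [s]) a" and "prefix (c @ [t]) b"
proof -
  have "strict_prefix c a" and "strict_prefix c b"
    using assms by (auto simp: lowest_common_ancestor_def common_ancestor_def)
  then obtain s a' t b' where ab: "a = c @ s # a'" "b = c @ t # b'"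
    by (metis strict_prefixE')
  then have prefixes: "prefix (c @ [s]) a" "prefix (c @ [t]) b"
    by auto
  have "s \<noteq> t"
  proof
    assume "s = t"
    then have "common_ancestor V a b (c @ [s])"
      using prefixes assms(1,2) by (auto simp: common_ancestor_def binary_tree_def)
    then have "prefix (c @ [s]) c"
      using lca unfolding lowest_common_ancestor_def by blast
    then show False
      by (auto dest: prefix_length_le)
  qed
  with prefixes show thesis
    using that by blast
qed

theorem theorem2p4:
  fixes P :: "('d::finite, 'm::finite, 'n::finite) minlp"
    and V :: "node set"
    and lab :: "node \<Rightarrow> 'n set \<times> 'n set"
    and a b c :: node
  assumes "minlp_data P"
    and "search_tree V lab"
    and "a \<in> V" and "b \<in> V"
    and "lowest_common_ancestor V a b c"
    and "c \<noteq> a" and "c \<noteq> b"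
  shows "Proj_x (F_node P (lab a)) \<inter> Proj_x (F_node P (lab b)) = {}"
proof -
  have "binary_tree V"
    using assms(2) by (simp add: search_tree_def)
  then obtain s t where "s \<noteq> t" and turns: "prefix (c @ [s]) a" "prefix (c @ [t]) b"
    using lowest_common_ancestor_turns assms by metis
  then consider "s = L" "t = R" | "s = R" "t = L"
    by (metis turn.exhaust)
  then show ?thesis
  proof cases
    case 1
    then obtain j where "j \<in> fst (lab a)" and "j \<in> snd (lab b)"
      using search_tree_branching_fixing[of V lab a b c] assms turns by blast
    then show ?thesis
      by (rule Proj_x_F_node_disjoint)
  next
    \<comment> \<open>Here \<open>b\<close> lies in the left branch, so \<open>a\<close> and
      \<open>b\<close> exchange roles.\<close>
    case 2
    then obtain j where "j \<in> fst (lab b)" and "j \<in> snd (lab a)"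
      using search_tree_branching_fixing[of V lab b a c] assms turns by blast
    then show ?thesis
      using Proj_x_F_node_disjoint by (metis Int_commute)
  qed
qed

end
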